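(* For every constant $\epsilon>0$, the flow LP for Constrained Connectivity-Degree has an integrality gap of $\Omega(n^{\frac19-\epsilon})$; that is, there are instances with $n$ vertices (for arbitrarily large $n$) on which the minimum possible maximum degree of a safely connected subgraph is $\Omega(n^{\frac19-\epsilon})$ times the optimal value of the degree flow LP.
   Context: Constrained Connectivity: given a graph $G=(V,E)$, $n=|V|$, and for each ordered pair $(u,v)\in V\times V$ a set $S(u,v)\subseteq V$ with $u,v\in S(u,v)$. A subgraph $H$ of $G$ is safely connected if for every ordered pair $(u,v)$ there is a $u$–$v$ path in $H$ all of whose vertices lie in $S(u,v)$; Constrained Connectivity-Degree minimizes the maximum degree of $H$. Let $\mathcal{P}_{uv}$ be the set of $u$–$v$ paths in $G$ contained in $S(u,v)$. The degree flow LP: minimize $\lambda$ subject to $\sum_{P\in\mathcal{P}_{uv}}f(P)\ge1$ for all $(u,v)$; $\sum_{P\in\mathcal{P}_{uv}:e\in P}f(P)\le c_e$ for all $e\in E$ and all $(u,v)$; $\sum_{v:\{u,v\}\in E}c_{\{u,v\}}\le\lambda$ for all $u\in V$; $0\le c_e\le1$; $0\le f(P)\le1$. *)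

theory Defs
  imports Complex_Main
begin

text \<open>A finite simple undirected graph is a finite vertex set with a set of two-element edges.\<close>

definition simple_graph :: "'v set \<Rightarrow> 'v set set \<Rightarrow> bool" where
  "simple_graph V E \<longleftrightarrow> finite V \<and> (\<forall>e\<in>E. e \<subseteq> V \<and> card e = 2)"

definition subgraph :: "'v set \<Rightarrow> 'v set set \<Rightarrow> 'v set \<Rightarrow> 'v set set \<Rightarrow> bool" where
  "subgraph W F V E \<longleftrightarrow> simple_graph W F \<and> W \<subseteq> V \<and> F \<subseteq> E"

definition neighbours :: "'v set set \<Rightarrow> 'v \<Rightarrow> 'v set" where
  "neighbours E u = {v. {u, v} \<in> E}"

definition max_degree :: "'v set \<Rightarrow> 'v set set \<Rightarrow> nat" where
  "max_degree V E = Max ((\<lambda>u. card (neighbours E u)) ` V)"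

text \<open>Paths are simple and are represented by their list of vertices, so the only path from
  \<open>u\<close> to \<open>u\<close> is the one-vertex path. The list also records the direction of the path: the
  paths from \<open>u\<close> to \<open>v\<close> and those from \<open>v\<close> to \<open>u\<close> are different objects when \<open>u \<noteq> v\<close>.\<close>

definition is_path :: "'v set \<Rightarrow> 'v set set \<Rightarrow> 'v \<Rightarrow> 'v \<Rightarrow> 'v list \<Rightarrow> bool" where
  "is_path V E u v p \<longleftrightarrow> p \<noteq> [] \<and> hd p = u \<and> last p = v \<and> distinct p \<and> set p \<subseteq> V \<and>
     successively (\<lambda>x y. {x, y} \<in> E) p"

definition path_edges :: "'v list \<Rightarrow> 'v set set" where
  "path_edges p = {{p ! i, p ! Suc i} | i. Suc i < length p}"

definition constrained_connectivity_instance ::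
  "'v set \<Rightarrow> 'v set set \<Rightarrow> ('v \<Rightarrow> 'v \<Rightarrow> 'v set) \<Rightarrow> bool" where
  "constrained_connectivity_instance V E S \<longleftrightarrow> simple_graph V E \<and>
     (\<forall>u\<in>V. \<forall>v\<in>V. S u v \<subseteq> V \<and> u \<in> S u v \<and> v \<in> S u v)"

definition safe_paths ::
  "'v set \<Rightarrow> 'v set set \<Rightarrow> ('v \<Rightarrow> 'v \<Rightarrow> 'v set) \<Rightarrow> 'v \<Rightarrow> 'v \<Rightarrow> 'v list set" where
  "safe_paths V E S u v = {p. is_path V E u v p \<and> set p \<subseteq> S u v}"

definition safely_connected_subgraph ::
  "'v set \<Rightarrow> 'v set set \<Rightarrow> ('v \<Rightarrow> 'v \<Rightarrow> 'v set) \<Rightarrow> 'v set \<Rightarrow> 'v set set \<Rightarrow> bool" where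
  "safely_connected_subgraph V E S W F \<longleftrightarrow> subgraph W F V E \<and>
     (\<forall>u\<in>V. \<forall>v\<in>V. \<exists>p. p \<in> safe_paths W F S u v)"

text \<open>Meaningful only if a safely connected subgraph exists and \<open>V\<close> is nonempty; the same
  holds for the value of the linear program below.\<close>

definition min_safe_degree ::
  "'v set \<Rightarrow> 'v set set \<Rightarrow> ('v \<Rightarrow> 'v \<Rightarrow> 'v set) \<Rightarrow> nat" where
  "min_safe_degree V E S =
     (LEAST d. \<exists>W F. safely_connected_subgraph V E S W F \<and> d = max_degree W F)"

definition degree_flow_LP_feasible ::
  "'v set \<Rightarrow> 'v set set \<Rightarrow> ('v \<Rightarrow> 'v \<Rightarrow> 'v set) \<Rightarrow>
     ('v set \<Rightarrow> real) \<Rightarrow> ('v list \<Rightarrow> real) \<Rightarrow> real \<Rightarrow> bool" where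
  "degree_flow_LP_feasible V E S c f l \<longleftrightarrow>
     (\<forall>u\<in>V. \<forall>v\<in>V. (\<Sum>p\<in>safe_paths V E S u v. f p) \<ge> 1) \<and>
     (\<forall>e\<in>E. \<forall>u\<in>V. \<forall>v\<in>V. (\<Sum>p\<in>{p \<in> safe_paths V E S u v. e \<in> path_edges p}. f p) \<le> c e) \<and>
     (\<forall>u\<in>V. (\<Sum>v\<in>neighbours E u. c {u, v}) \<le> l) \<and>
     (\<forall>e\<in>E. 0 \<le> c e \<and> c e \<le> 1) \<and>
     (\<forall>u\<in>V. \<forall>v\<in>V. \<forall>p\<in>safe_paths V E S u v. 0 \<le> f p \<and> f p \<le> 1)"

definition degree_flow_LP_value ::
  "'v set \<Rightarrow> 'v set set \<Rightarrow> ('v \<Rightarrow> 'v \<Rightarrow> 'v set) \<Rightarrow> real" where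
  "degree_flow_LP_value V E S = Inf {l. \<exists>c f. degree_flow_LP_feasible V E S c f l}"

end

theory Submission
  imports Defs
begin

text \<open>
  Take the points \<open>(i, x)\<close> with \<open>i < m\<close>, \<open>x < m\<^sup>2\<close> and the lines \<open>y = x + i * j\<close> of slope
  \<open>j < m\<close>. A left hub \<open>i\<close> is joined to the points of column \<open>i\<close>, a right hub \<open>j\<close> to the
  lines of slope \<open>j\<close>, and a point to the lines through it. A safe path from the left hub \<open>i\<close>
  to the right hub \<open>j\<close> has to pass through an incident point and line of these two groups.
  Fractionally, capacity \<open>1 / m\<^sup>2\<close> on every edge suffices, so the fractional degree stays
  bounded. Integrally, if all hubs have degree at most \<open>d\<close>, then by the pigeonhole principle
  some line of each slope contains \<open>m / d\<close> of the at most \<open>m * d\<close> selected points; as two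
  lines of different slope share at most one point, this forces \<open>d\<close> to be of order
  \<open>m powr (1/3)\<close>. The graph has of the order of \<open>m\<^sup>3\<close> vertices, hence the exponent \<open>1/9\<close>.
\<close>

section \<open>Counting incidences of points and lines\<close>

text \<open>In the induction step the set \<open>L t\<close> meets the union of its \<open>t\<close>
  predecessors in at most \<open>t\<close> elements, so it adds at least \<open>r - t\<close> new
  ones. The terms \<open>t\<close> and \<open>t * t\<close> are placed so that no natural
  subtraction arises.\<close>

lemma card_UN_ge_of_small_intersections:
  fixes L :: "nat \<Rightarrow> 'a set"
  assumes "\<And>j. j < t \<Longrightarrow> finite (L j)" "\<And>j. j < t \<Longrightarrow> r \<le> card (L j)"
    and "\<And>i j. i < j \<Longrightarrow> j < t \<Longrightarrow> card (L i \<inter> L j) \<le> 1"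
  shows "t * r + t \<le> card (\<Union>j<t. L j) + t * t"
  using assms
proof (induction t)
  case (Suc t)
  let ?U = "\<Union>j<t. L j"
  have IH: "t * r + t \<le> card ?U + t * t"
    using Suc.prems by (intro Suc.IH) auto
  have "card (?U \<inter> L t) = card (\<Union>j<t. L j \<inter> L t)"
    by (simp only: Int_UN_distrib2 UN_extend_simps)
  also have "\<dots> \<le> (\<Sum>j<t. card (L j \<inter> L t))"
    by (rule card_UN_le) simp
  also have "\<dots> \<le> t"
    using sum_mono[of "{..<t}" "\<lambda>j. card (L j \<inter> L t)" "\<lambda>_. 1"] Suc.prems(3) by simp
  finally have "card (?U \<inter> L t) \<le> t" .
  moreover have "card ?U + card (L t) = card (?U \<union> L t) + card (?U \<inter> L t)"
    using Suc.prems(1) by (intro card_Un_Int) auto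
  moreover have "?U \<union> L t = (\<Union>j<Suc t. L j)"
    by (auto simp: less_Suc_eq)
  ultimately show ?case
    using IH Suc.prems(2)[of t] by simp
qed simp

text \<open>Subtracting the equations of the two lines at a common point determines
  \<open>i * (j' - j)\<close>, hence \<open>i\<close>, and then \<open>x\<close>.\<close>

lemma lines_meet_once:
  fixes i j x :: nat
  assumes "j < j'" "x + i * j = y" "x + i * j' = y'" "x' + i' * j = y" "x' + i' * j' = y'"
  shows "i = i' \<and> x = x'"
proof -
  obtain e where e: "j' = j + e" "e > 0"
    using assms(1) less_imp_add_positive by blast
  have "i * e = i' * e"
    using assms(2-5) unfolding e(1) distrib_left by linarith
  then have "i = i'"
    using e(2) by simp
  then show ?thesis
    using assms(2,4) by simp
qed

text \<open>
  \<open>P i\<close> and \<open>Q j\<close> are the points of column \<open>i\<close> and the lines of slope \<open>j\<close> selected by an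
  integral solution.
\<close>

lemma incidence_bound:
  fixes P Q :: "nat \<Rightarrow> nat set"
  assumes P: "\<And>i. i < m \<Longrightarrow> finite (P i) \<and> card (P i) \<le> d"
    and Q: "\<And>j. j < m \<Longrightarrow> finite (Q j) \<and> card (Q j) \<le> d"
    and inc: "\<And>i j. i < m \<Longrightarrow> j < m \<Longrightarrow> \<exists>x\<in>P i. x + i * j \<in> Q j"
    and m: "m = 4 * s ^ 3" and s: "s > 0"
  shows "s < d"
proof (rule ccontr)
  assume "\<not> s < d"
  then have ds: "d \<le> s" by simp
  define I where "I j y = {i. i < m \<and> (\<exists>x\<in>P i. x + i * j = y)}" for j y
  \<comment> \<open>Pigeonhole: each of the \<open>4 * s ^ 3\<close> columns has a selected point on
    one of the at most \<open>s\<close> lines in \<open>Q j\<close>, so some line is hit from at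
    least \<open>4 * s^2\<close> columns.\<close>
  have "\<exists>y. 4 * s^2 \<le> card (I j y)" if j: "j < m" for j
  proof (rule ccontr)
    assume "\<not> ?thesis"
    then have small: "card (I j y) \<le> 4 * s^2 - 1" for y
      by (auto simp: not_le intro: less_Suc_eq_le[THEN iffD1] dest: spec[of _ y])
    have "{..<m} \<subseteq> (\<Union>y\<in>Q j. I j y)"
    proof
      fix i assume "i \<in> {..<m}"
      then obtain x where "x \<in> P i" "x + i * j \<in> Q j"
        using inc j by auto
      then show "i \<in> (\<Union>y\<in>Q j. I j y)"
        using \<open>i \<in> {..<m}\<close> by (auto simp: I_def)
    qed
    then have "m \<le> card (\<Union>y\<in>Q j. I j y)"
      using card_mono[of "\<Union>y\<in>Q j. I j y" "{..<m}"] Q[OF j] by (simp add: I_def)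
    also have "\<dots> \<le> (\<Sum>y\<in>Q j. card (I j y))"
      using Q[OF j] by (intro card_UN_le) auto
    also have "\<dots> \<le> card (Q j) * (4 * s^2 - 1)"
      using sum_bounded_above[of "Q j" "\<lambda>y. card (I j y)" "4 * s^2 - 1"] small by simp
    also have "\<dots> \<le> s * (4 * s^2 - 1)"
      using Q[OF j] ds by (intro mult_right_mono) auto
    also have "\<dots> < s * (4 * s^2)"
      using s by (intro mult_strict_left_mono) auto
    also have "\<dots> = m"
      using m by (simp add: power2_eq_square power3_eq_cube)
    finally show False by simp
  qed
  then obtain y where y: "\<And>j. j < m \<Longrightarrow> 4 * s^2 \<le> card (I j (y j))"
    by metis
  define L where "L j = {(i, x). i < m \<and> x \<in> P i \<and> x + i * j = y j}" for j
  have sub: "L j \<subseteq> Sigma {..<m} P" for j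
    by (auto simp: L_def)
  have finS: "finite (Sigma {..<m} P)"
    using P by auto
  have fin: "finite (L j)" for j
    using sub finS by (rule finite_subset)
  have r: "4 * s^2 \<le> card (L j)" if "j < m" for j
  proof -
    have "I j (y j) \<subseteq> fst ` L j"
    proof
      fix i assume "i \<in> I j (y j)"
      then obtain x where "(i, x) \<in> L j"
        by (auto simp: I_def L_def)
      then show "i \<in> fst ` L j" by force
    qed
    then show ?thesis
      using surj_card_le[OF fin] y[OF that] le_trans by blast
  qed
  have int: "card (L i \<inter> L j) \<le> 1" if "i < j" for i j
  proof -
    have "a = b" if "a \<in> L i \<inter> L j" "b \<in> L i \<inter> L j" for a b
      using that lines_meet_once[OF \<open>i < j\<close>, of "snd a" "fst a" "y i" "y j" "snd b" "fst b"]
      by (auto simp: L_def)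
    then show ?thesis
      using fin by (simp add: card_le_Suc0_iff_eq)
  qed
  \<comment> \<open>Half of \<open>4 * s^2\<close>, which maximises
    \<open>t * (4 * s^2) - t * t\<close>. The maximum equals \<open>m * s\<close>, so the extra
    summand \<open>t\<close> in the union bound yields the contradiction.\<close>
  define t where "t = 2 * s^2"
  have "t \<le> m"
    using s by (simp add: t_def m power2_eq_square power3_eq_cube)
  then have "t * (4 * s^2) + t \<le> card (\<Union>j<t. L j) + t * t"
    using fin r int by (intro card_UN_ge_of_small_intersections) auto
  also have "card (\<Union>j<t. L j) \<le> card (Sigma {..<m} P)"
    using sub finS by (intro card_mono) auto
  also have "\<dots> = (\<Sum>i<m. card (P i))"
    using P by simp
  also have "\<dots> \<le> m * s"
    using sum_bounded_above[of "{..<m}" "\<lambda>i. card (P i)" s] P ds by force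
  finally have "t * (4 * s^2) + t \<le> m * s + t * t" by simp
  moreover have "m * s + t * t = t * (4 * s^2)"
    by (simp add: m t_def power2_eq_square power3_eq_cube)
  ultimately show False
    using s by (simp add: t_def)
qed

section \<open>Path edges and a lower bound for the linear program\<close>

lemma hd_edge_in_path_edges:
  assumes "is_path V E u v p" "u \<noteq> v"
  shows "{u, p ! 1} \<in> E" "{u, p ! 1} \<in> path_edges p"
proof -
  obtain w q where p: "p = u # w # q"
    using assms unfolding is_path_def by (metis last_ConsL list.exhaust_sel)
  show "{u, p ! 1} \<in> E"
    using assms(1) by (simp add: p is_path_def)
  have "\<exists>i. {u, p ! 1} = {p ! i, p ! Suc i} \<and> Suc i < length p"
    by (intro exI[of _ 0]) (simp add: p)
  then show "{u, p ! 1} \<in> path_edges p"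
    by (simp add: path_edges_def)
qed

lemma finite_safe_paths:
  assumes "finite V"
  shows "finite (safe_paths V E S u v)"
proof (rule finite_subset)
  show "safe_paths V E S u v \<subseteq> {p. set p \<subseteq> V \<and> length p \<le> card V}"
    using assms by (auto simp: safe_paths_def is_path_def) (metis card_mono distinct_card)
  show "finite {p. set p \<subseteq> V \<and> length p \<le> card V}"
    using assms by (rule finite_lists_length_le)
qed

text \<open>All flow from \<open>u\<close> to \<open>v\<close> leaves \<open>u\<close> along its
  incident edges, so their capacities sum to at least the demand 1.\<close>

lemma degree_flow_LP_feasible_ge_1:
  assumes "simple_graph V E" "degree_flow_LP_feasible V E S c f l" "u \<in> V" "v \<in> V" "u \<noteq> v"
  shows "1 \<le> l"
proof -
  let ?P = "safe_paths V E S u v"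
  let ?N = "neighbours E u"
  have "finite V" and "?N \<subseteq> V"
    using assms(1) by (auto simp: simple_graph_def neighbours_def)
  then have fin: "finite ?N" "finite ?P"
    by (auto intro: finite_subset finite_safe_paths)
  have cap: "(\<Sum>p\<in>{p \<in> ?P. {u, w} \<in> path_edges p}. f p) \<le> c {u, w}" if "w \<in> ?N" for w
    using assms(2-4) that by (auto simp: degree_flow_LP_feasible_def neighbours_def)
  have nonneg: "0 \<le> f p" if "p \<in> ?P" for p
    using assms(2-4) that by (auto simp: degree_flow_LP_feasible_def)
  have first_edge: "{u, p ! 1} \<in> path_edges p" if "p \<in> ?P" for p
    using that hd_edge_in_path_edges(2) assms(5) by (auto simp: safe_paths_def)
  have nb: "(\<lambda>p. p ! 1) ` ?P \<subseteq> ?N"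
    using hd_edge_in_path_edges(1) assms(5) by (fastforce simp: safe_paths_def neighbours_def)
  have "1 \<le> (\<Sum>p\<in>?P. f p)"
    using assms(2-4) by (auto simp: degree_flow_LP_feasible_def)
  \<comment> \<open>Paths are grouped by their second vertex, the far end of their first
    edge.\<close>
  also have "\<dots> = (\<Sum>w\<in>?N. \<Sum>p\<in>{p \<in> ?P. p ! 1 = w}. f p)"
    using sum.group[OF fin(2,1) nb, of f] by simp
  also have "\<dots> \<le> (\<Sum>w\<in>?N. \<Sum>p\<in>{p \<in> ?P. {u, w} \<in> path_edges p}. f p)"
    using fin(2) nonneg first_edge by (intro sum_mono sum_mono2) auto
  also have "\<dots> \<le> (\<Sum>w\<in>?N. c {u, w})"
    using cap by (rule sum_mono)
  also have "\<dots> \<le> l"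
    using assms(2,3) by (auto simp: degree_flow_LP_feasible_def)
  finally show ?thesis .
qed


lemma path_edges_Cons2: "path_edges (x # y # p) = insert {x, y} (path_edges (y # p))"
proof -
  have "{i. Suc i < length (x # y # p)} = insert 0 (Suc ` {i. Suc i < length (y # p)})"
    by (auto simp: image_iff gr0_conv_Suc less_Suc_eq_0_disj)
  then show ?thesis
    by (simp only: path_edges_def setcompr_eq_image image_insert image_image nth_Cons_0 nth_Cons_Suc)
qed

lemma path_edges_singleton: "path_edges [x] = {}"
  by (simp add: path_edges_def)

lemma successively_iff_path_edges:
  "successively (\<lambda>x y. {x, y} \<in> F) p \<longleftrightarrow> path_edges p \<subseteq> F"
  by (auto simp: successively_conv_nth path_edges_def)

section \<open>The incidence graph and its degrees\<close>

datatype vertex = Left nat | Right nat | Point nat nat | Line nat nat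

text \<open>The range \<open>2 * m^2\<close> for lines covers \<open>x + i * j\<close> for all
  \<open>x < m^2\<close> and \<open>i, j < m\<close>.\<close>

definition verts :: "nat \<Rightarrow> vertex set" where
  "verts m = Left ` {..<m} \<union> Right ` {..<m} \<union>
     case_prod Point ` ({..<m} \<times> {..<m^2}) \<union> case_prod Line ` ({..<m} \<times> {..<2 * m^2})"

text \<open>Links are oriented from left hubs through points and lines to right hubs; undirected
  adjacency is \<open>link r s \<or> link s r\<close>.\<close>

fun link :: "vertex \<Rightarrow> vertex \<Rightarrow> bool" where
  "link (Left i) (Point i' x) \<longleftrightarrow> i = i'"
| "link (Point i x) (Line j y) \<longleftrightarrow> y = x + i * j"
| "link (Line j y) (Right j') \<longleftrightarrow> j = j'"
| "link _ _ \<longleftrightarrow> False"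

lemma verts_simps [simp]:
  "Left i \<in> verts m \<longleftrightarrow> i < m" "Right j \<in> verts m \<longleftrightarrow> j < m"
  "Point i x \<in> verts m \<longleftrightarrow> i < m \<and> x < m^2" "Line j y \<in> verts m \<longleftrightarrow> j < m \<and> y < 2 * m^2"
  by (auto simp: verts_def image_iff)

lemma link_irrefl: "\<not> link r r"
  by (cases r) auto

lemma finite_verts: "finite (verts m)"
  by (simp add: verts_def)

lemma card_verts_ge: "m \<le> card (verts m)"
proof -
  have "card (Left ` {..<m}) = m"
    by (simp add: card_image inj_on_def)
  moreover have "Left ` {..<m} \<subseteq> verts m"
    by auto
  ultimately show ?thesis
    using card_mono[OF finite_verts, of "Left ` {..<m}" m] by simp
qed

lemma card_verts_le: "card (verts m) \<le> 5 * m ^ 3"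
proof -
  have "card (verts m) \<le> m + m + m * m^2 + m * (2 * m^2)"
    unfolding verts_def
    by (intro order_trans[OF card_Un_le] add_mono order_trans[OF card_image_le]) simp_all
  also have "\<dots> \<le> 5 * m ^ 3"
    using self_le_power[of m 3] by (cases "m = 0") (auto simp: power2_eq_square power3_eq_cube)
  finally show ?thesis .
qed

text \<open>Hubs dominate: a left hub sees at most \<open>m^2\<close> points, a right hub at most
  \<open>2 * m^2\<close> lines, a point or a line at most \<open>m + 1\<close> vertices. At capacity
  \<open>1 / m^2\<close> per edge this costs at most 2 in the fractional degree.\<close>

lemma card_linked_le:
  assumes "0 < m"
  shows "card {s \<in> verts m. link r s \<or> link s r} \<le> 2 * m^2"
proof -
  let ?N = "{s \<in> verts m. link r s \<or> link s r}"
  have m: "m + 1 \<le> 2 * m^2"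
    using assms le_square[of m] unfolding power2_eq_square by linarith
  have bound: "card ?N \<le> 2 * m^2"
    if "?N \<subseteq> B" "finite B" "card B \<le> 2 * m^2" for B
    using card_mono[OF that(2,1)] that(3) by simp
  show ?thesis
  proof (cases r)
    case (Left i)
    have "?N \<subseteq> Point i ` {..<m^2}"
    proof
      fix s assume "s \<in> ?N" then show "s \<in> Point i ` {..<m^2}"
        by (cases s) (auto simp: Left)
    qed
    moreover have "card (Point i ` {..<m^2}) \<le> 2 * m^2"
      by (rule order_trans[OF card_image_le]) auto
    ultimately show ?thesis by (intro bound) auto
  next
    case (Right j)
    have "?N \<subseteq> Line j ` {..<2 * m^2}"
    proof
      fix s assume "s \<in> ?N" then show "s \<in> Line j ` {..<2 * m^2}"
        by (cases s) (auto simp: Right)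
    qed
    moreover have "card (Line j ` {..<2 * m^2}) \<le> 2 * m^2"
      by (rule order_trans[OF card_image_le]) auto
    ultimately show ?thesis by (intro bound) auto
  next
    case (Point i x)
    let ?B = "insert (vertex.Left i) ((\<lambda>j. Line j (x + i * j)) ` {..<m})"
    have "?N \<subseteq> ?B"
    proof
      fix s assume "s \<in> ?N" then show "s \<in> ?B"
        by (cases s) (auto simp: Point)
    qed
    moreover have "card ?B \<le> 2 * m^2"
      using card_image_le[of "{..<m}" "\<lambda>j. Line j (x + i * j)"] m
      by (intro order_trans[OF card_insert_le_m1[of "m + 1"]]) auto
    ultimately show ?thesis by (intro bound) auto
  next
    case (Line j y)
    \<comment> \<open>\<open>?B\<close> is only an upper bound, so the truncated values of
      \<open>y - i * j\<close> for \<open>i * j > y\<close> are harmless.\<close>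
    let ?B = "insert (vertex.Right j) ((\<lambda>i. Point i (y - i * j)) ` {..<m})"
    have "?N \<subseteq> ?B"
    proof
      fix s assume "s \<in> ?N" then show "s \<in> ?B"
        by (cases s) (auto simp: Line)
    qed
    moreover have "card ?B \<le> 2 * m^2"
      using card_image_le[of "{..<m}" "\<lambda>i. Point i (y - i * j)"] m
      by (intro order_trans[OF card_insert_le_m1[of "m + 1"]]) auto
    ultimately show ?thesis by (intro bound) auto
  qed
qed


section \<open>The constrained connectivity instance\<close>

text \<open>The path from \<open>u\<close> to \<open>v\<close> inside the Hamiltonian path on the
  integers, walked upwards or downwards because paths are directed lists.\<close>

definition span :: "nat \<Rightarrow> nat \<Rightarrow> nat list" where
  "span u v = (if u \<le> v then [u..<Suc v] else rev [v..<Suc u])"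

lemma span_props:
  "span u v \<noteq> []" "hd (span u v) = u" "last (span u v) = v" "distinct (span u v)"
  "set (span u v) = {min u v..max u v}"
  by (auto simp: span_def hd_rev last_rev hd_append simp del: upt_Suc)

lemma successively_span:
  assumes "\<And>i. Suc i \<le> max u v \<Longrightarrow> {i, Suc i} \<in> F"
  shows "successively (\<lambda>x y. {x, y} \<in> F) (span u v)"
proof -
  have "successively (\<lambda>x y. {x, y} \<in> F) [a..<Suc b]" if "b \<le> max u v" for a b
    using assms that by (auto simp: successively_conv_nth simp del: upt_Suc)
  from this[of v u] this[of u v] show ?thesis
    by (auto simp: span_def insert_commute simp del: upt_Suc)
qed

text \<open>\<open>g\<close> numbers the incidence graph inside the naturals below \<open>n\<close>;
  the parity condition keeps any two images from being consecutive.\<close>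

locale incidence_instance =
  fixes m n :: nat and g :: "vertex \<Rightarrow> nat"
  assumes m_pos: "0 < m"
    and inj_g: "inj_on g (verts m)"
    and g_less: "r \<in> verts m \<Longrightarrow> g r < n"
    and g_even: "r \<in> verts m \<Longrightarrow> even (g r)"
begin

definition V :: "nat set" where "V = {..<n}"

text \<open>
  The vertices of the incidence graph sit at even numbers, so the Hamiltonian path \<open>0, 1, 2, \<dots>\<close>
  connects all pairs at bounded degree but is useless inside a safe set that contains only even
  numbers.
\<close>

definition spine :: "nat set set" where
  "spine = {{i, Suc i} | i. Suc i < n}"

definition E :: "nat set set" where
  "E = spine \<union> {{g r, g s} | r s. r \<in> verts m \<and> s \<in> verts m \<and> link r s}"

definition group :: "nat \<Rightarrow> nat \<Rightarrow> vertex set" where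
  "group i j = {Left i, Right j} \<union> Point i ` {..<m^2} \<union> Line j ` {..<2 * m^2}"

text \<open>Only ordered pairs from a left hub to a right hub are restricted; for all other pairs
  the condition is vacuous. As \<open>g\<close> is injective on \<open>verts m\<close>, at most one
  choice of \<open>i\<close> and \<open>j\<close> matches.\<close>

definition S :: "nat \<Rightarrow> nat \<Rightarrow> nat set" where
  "S u v = {w \<in> V. \<forall>i<m. \<forall>j<m. u = g (Left i) \<and> v = g (Right j) \<longrightarrow> w \<in> g ` group i j}"

definition hubs :: "nat \<Rightarrow> nat \<Rightarrow> bool" where
  "hubs u v \<longleftrightarrow> (\<exists>i<m. \<exists>j<m. u = g (Left i) \<and> v = g (Right j))"

definition route :: "nat \<Rightarrow> nat \<Rightarrow> nat \<Rightarrow> nat list" where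
  "route i j x = map g [Left i, Point i x, Line j (x + i * j), Right j]"

lemma g_eq_iff: "r \<in> verts m \<Longrightarrow> s \<in> verts m \<Longrightarrow> g r = g s \<longleftrightarrow> r = s"
  using inj_g by (auto dest: inj_onD)

lemma group_subset: "i < m \<Longrightarrow> j < m \<Longrightarrow> group i j \<subseteq> verts m"
  by (auto simp: group_def)

lemma line_less:
  assumes "i < m" "j < m" "x < m^2" shows "x + i * j < 2 * m^2"
  using assms mult_strict_mono[of i m j m] by (simp add: power2_eq_square)

lemma S_hubs:
  assumes "i < m" "j < m" shows "S (g (Left i)) (g (Right j)) = g ` group i j"
  using assms group_subset[OF assms] g_less by (auto simp: S_def V_def g_eq_iff)

lemma S_other: "\<not> hubs u v \<Longrightarrow> S u v = V"
  by (auto simp: S_def hubs_def)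

text \<open>Two even numbers are never consecutive, so the spine adds no edge between images of
  \<open>g\<close>.\<close>

lemma g_edge_iff:
  assumes "r \<in> verts m" "s \<in> verts m"
  shows "{g r, g s} \<in> E \<longleftrightarrow> link r s \<or> link s r"
proof -
  have "{g r, g s} \<notin> spine"
    using g_even[OF assms(1)] g_even[OF assms(2)] by (auto simp: spine_def doubleton_eq_iff)
  then show ?thesis
    using assms by (auto simp: E_def doubleton_eq_iff g_eq_iff)
qed

lemma simple_graph: "simple_graph V E"
proof -
  have "e \<subseteq> V \<and> card e = 2" if "e \<in> E" for e
    using that unfolding E_def
  proof
    assume "e \<in> spine"
    then show ?thesis by (auto simp: spine_def V_def)
  next
    assume "e \<in> {{g r, g s} | r s. r \<in> verts m \<and> s \<in> verts m \<and> link r s}"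
    then obtain r s where rs: "e = {g r, g s}" "r \<in> verts m" "s \<in> verts m" "link r s"
      by auto
    then have "g r \<noteq> g s"
      using link_irrefl by (auto simp: g_eq_iff)
    then show ?thesis
      using rs g_less by (simp add: V_def)
  qed
  then show ?thesis
    by (simp add: simple_graph_def V_def)
qed

lemma instance_constrained_connectivity: "constrained_connectivity_instance V E S"
proof -
  have "u \<in> S u v \<and> v \<in> S u v" if "u \<in> V" "v \<in> V" for u v
  proof (cases "hubs u v")
    case True
    then show ?thesis by (auto simp: hubs_def S_hubs group_def)
  qed (use that S_other in auto)
  then show ?thesis
    using simple_graph by (auto simp: constrained_connectivity_instance_def S_def)
qed

lemma safe_span:
  assumes "u \<in> V" "v \<in> V" "\<not> hubs u v"
  shows "span u v \<in> safe_paths V E S u v"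
proof -
  have "successively (\<lambda>x y. {x, y} \<in> E) (span u v)"
    using assms by (intro successively_span) (auto simp: E_def spine_def V_def)
  then show ?thesis
    using assms by (auto simp: safe_paths_def is_path_def span_props S_other V_def)
qed

lemma span_edges: "u \<in> V \<Longrightarrow> v \<in> V \<Longrightarrow> path_edges (span u v) \<subseteq> spine"
  unfolding successively_iff_path_edges[symmetric]
  by (intro successively_span) (auto simp: spine_def V_def)

lemma safe_route:
  assumes "i < m" "j < m" "x < m^2"
  shows "route i j x \<in> safe_paths V E S (g (Left i)) (g (Right j))"
  using assms line_less[OF assms] g_less
  by (auto simp: safe_paths_def is_path_def route_def S_hubs g_edge_iff g_eq_iff V_def group_def)

lemma route_edges:
  "path_edges (route i j x) = (`) g ` {{Left i, Point i x},
     {Point i x, Line j (x + i * j)}, {Line j (x + i * j), Right j}}"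
  by (simp add: route_def path_edges_Cons2 path_edges_singleton)

text \<open>For fixed \<open>i\<close> and \<open>j\<close>, every edge of a route contains its
  point or its line, and either determines \<open>x\<close>. Hence sending \<open>1 / m^2\<close>
  along every route loads no edge with more than \<open>1 / m^2\<close>.\<close>

lemma routes_edge_disjoint:
  assumes "i < m" "j < m" "x < m^2" "x' < m^2"
    "e \<in> path_edges (route i j x)" "e \<in> path_edges (route i j x')"
  shows "x = x'"
  using assms(5,6) assms(1-4) line_less[OF assms(1,2,3)] line_less[OF assms(1,2,4)]
  by (auto simp: route_edges doubleton_eq_iff g_eq_iff)

lemma route_inj: "i < m \<Longrightarrow> j < m \<Longrightarrow> inj_on (route i j) {..<m^2}"
  by (rule inj_onI) (simp add: route_def g_eq_iff)


section \<open>The fractional solution\<close>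

definition cap :: "nat set \<Rightarrow> real" where
  "cap e = (if e \<in> spine then 1 else 1 / real (m^2))"

text \<open>One function serves all pairs, so the pair is read off from the ends of the path: hub
  pairs spread a unit evenly over their \<open>m^2\<close> routes, other pairs send a unit along the
  spine.\<close>

definition flow :: "nat list \<Rightarrow> real" where
  "flow p =
     (if hubs (hd p) (last p)
      then if \<exists>i<m. \<exists>j<m. \<exists>x<m^2. p = route i j x then 1 / real (m^2) else 0
      else if p = span (hd p) (last p) then 1 else 0)"

lemma finite_V: "finite V"
  by (simp add: V_def)

text \<open>The predicate \<open>\<Phi>\<close> lets one computation serve both the demand
  constraint (\<open>\<Phi>\<close> always true) and the capacity constraints (\<open>\<Phi>\<close>
  says that the path uses a given edge).\<close>

lemma flow_hubs:
  assumes "i < m" "j < m"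
  shows "(\<Sum>p\<in>{p \<in> safe_paths V E S (g (Left i)) (g (Right j)). \<Phi> p}. flow p) =
    card {x. x < m^2 \<and> \<Phi> (route i j x)} / real (m^2)"
proof -
  let ?X = "{x. x < m^2 \<and> \<Phi> (route i j x)}"
  let ?P = "{p \<in> safe_paths V E S (g (Left i)) (g (Right j)). \<Phi> p}"
  have ends: "hd p = g (Left i)" "last p = g (Right j)" if "p \<in> ?P" for p
    using that by (auto simp: safe_paths_def is_path_def)
  have sub: "route i j ` ?X \<subseteq> ?P"
    using safe_route assms by auto
  have "flow p = 0" if "p \<in> ?P - route i j ` ?X" for p
  proof -
    have "p \<noteq> route i' j' x" if "i' < m" "j' < m" "x < m^2" for i' j' x
    proof
      assume eq: "p = route i' j' x"
      then have "i' = i" "j' = j"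
        using ends[of p] \<open>p \<in> _\<close> that assms by (auto simp: route_def g_eq_iff)
      then show False
        using \<open>p \<in> _\<close> eq that(3) by auto
    qed
    then show ?thesis
      using ends[of p] that assms by (auto simp: flow_def hubs_def)
  qed
  then have "(\<Sum>p\<in>?P. flow p) = (\<Sum>p\<in>route i j ` ?X. flow p)"
    using sub finite_safe_paths[OF finite_V] by (intro sum.mono_neutral_right) auto
  also have "\<dots> = (\<Sum>p\<in>route i j ` ?X. 1 / real (m^2))"
  proof (intro sum.cong refl)
    fix p assume p: "p \<in> route i j ` ?X"
    then have "hubs (hd p) (last p)"
      using ends[of p] sub assms by (auto simp: hubs_def)
    then show "flow p = 1 / real (m^2)"
      using p assms by (auto simp: flow_def)
  qed
  also have "\<dots> = card (route i j ` ?X) / real (m^2)"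
    by simp
  also have "card (route i j ` ?X) = card ?X"
    by (intro card_image inj_on_subset[OF route_inj[OF assms]]) auto
  finally show ?thesis .
qed

lemma flow_other:
  assumes "u \<in> V" "v \<in> V" "\<not> hubs u v"
  shows "(\<Sum>p\<in>{p \<in> safe_paths V E S u v. \<Phi> p}. flow p) = (if \<Phi> (span u v) then 1 else 0)"
proof -
  let ?P = "{p \<in> safe_paths V E S u v. \<Phi> p}"
  have "flow p = (if p = span u v then 1 else 0)" if "p \<in> ?P" for p
    using that assms(3) by (auto simp: flow_def safe_paths_def is_path_def)
  then have "(\<Sum>p\<in>?P. flow p) = (\<Sum>p\<in>?P. if p = span u v then 1 else 0)"
    by (intro sum.cong) auto
  also have "\<dots> = (if \<Phi> (span u v) then 1 else 0)"
    using safe_span[OF assms] finite_safe_paths[OF finite_V] by simp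
  finally show ?thesis .
qed

lemma flow_ge_1:
  assumes "u \<in> V" "v \<in> V"
  shows "1 \<le> (\<Sum>p\<in>safe_paths V E S u v. flow p)"
proof (cases "hubs u v")
  case True
  then obtain i j where "i < m" "j < m" "u = g (Left i)" "v = g (Right j)"
    by (auto simp: hubs_def)
  then show ?thesis
    using flow_hubs[of i j "\<lambda>_. True"] m_pos by simp
next
  case False
  then show ?thesis
    using flow_other[OF assms, of "\<lambda>_. True"] by simp
qed

lemma flow_le_cap:
  assumes "u \<in> V" "v \<in> V"
  shows "(\<Sum>p\<in>{p \<in> safe_paths V E S u v. e \<in> path_edges p}. flow p) \<le> cap e"
proof (cases "hubs u v")
  case True
  then obtain i j where ij: "i < m" "j < m" "u = g (Left i)" "v = g (Right j)"
    by (auto simp: hubs_def)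
  have "card {x. x < m^2 \<and> e \<in> path_edges (route i j x)} \<le> 1"
    using routes_edge_disjoint[OF ij(1,2)] by (auto simp: card_le_Suc0_iff_eq)
  then have "card {x. x < m^2 \<and> e \<in> path_edges (route i j x)} / real (m^2) \<le> 1 / real (m^2)"
    by (intro divide_right_mono) auto
  also have "\<dots> \<le> cap e"
    using m_pos by (auto simp: cap_def)
  finally show ?thesis
    using flow_hubs[OF ij(1,2)] ij by simp
next
  case False
  then show ?thesis
    using flow_other[OF assms] span_edges[OF assms] by (auto simp: cap_def)
qed

text \<open>At most two spine edges of capacity 1 meet \<open>u\<close>, and at most
  \<open>2 * m^2\<close> other edges of capacity \<open>1 / m^2\<close> add at most 2 more.\<close>

lemma cap_degree:
  assumes "u \<in> V"
  shows "(\<Sum>v\<in>neighbours E u. cap {u, v}) \<le> 4"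
proof -
  let ?N = "neighbours E u"
  let ?M = "{v. {u, v} \<in> spine}"
  have "?N \<subseteq> V"
    using simple_graph by (auto simp: simple_graph_def neighbours_def)
  then have fin: "finite ?N"
    using finite_V finite_subset by blast
  \<comment> \<open>For \<open>u = 0\<close> the truncated \<open>u - 1\<close> only enlarges the
    bounding set.\<close>
  have "?M \<subseteq> {u - 1, Suc u}"
    by (auto simp: spine_def doubleton_eq_iff)
  then have "card (?N \<inter> ?M) \<le> card {u - 1, Suc u}"
    by (intro card_mono) auto
  also have "\<dots> \<le> 2"
    by (simp add: card_insert_if)
  finally have M: "card (?N \<inter> ?M) \<le> 2" .
  have N: "card (?N - ?M) \<le> 2 * m^2"
  proof (cases "u \<in> g ` verts m")
    case True
    then obtain r where r: "r \<in> verts m" "u = g r" by auto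
    have "?N - ?M \<subseteq> g ` {s \<in> verts m. link r s \<or> link s r}"
      using r by (auto simp: neighbours_def E_def doubleton_eq_iff g_eq_iff)
    then have "card (?N - ?M) \<le> card {s \<in> verts m. link r s \<or> link s r}"
      using finite_verts by (intro surj_card_le) auto
    also have "\<dots> \<le> 2 * m^2"
      using m_pos by (rule card_linked_le)
    finally show ?thesis .
  next
    case False
    then have empty: "?N - ?M = {}"
      by (auto simp: neighbours_def E_def doubleton_eq_iff)
    show ?thesis
      unfolding empty by simp
  qed
  have "(\<Sum>v\<in>?N. cap {u, v}) =
      (\<Sum>v\<in>?N \<inter> ?M. cap {u, v}) + (\<Sum>v\<in>?N - ?M. cap {u, v})"
    using fin by (rule sum.Int_Diff)
  also have "\<dots> = card (?N \<inter> ?M) + card (?N - ?M) / real (m^2)"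
    by (simp add: cap_def)
  also have "\<dots> \<le> 2 + real (2 * m^2) / real (m^2)"
  proof (intro add_mono divide_right_mono)
    show "real (card (?N \<inter> ?M)) \<le> 2"
      using M by simp
    show "real (card (?N - ?M)) \<le> real (2 * m^2)"
      using N by (simp only: of_nat_le_iff)
  qed simp
  also have "\<dots> = 4"
    using m_pos by simp
  finally show ?thesis .
qed

lemma LP_feasible: "degree_flow_LP_feasible V E S cap flow 4"
proof -
  have "1 / real (m^2) \<le> 1"
    using m_pos by simp
  then have "0 \<le> cap e \<and> cap e \<le> 1" "0 \<le> flow p \<and> flow p \<le> 1" for e p
    by (auto simp: cap_def flow_def)
  then show ?thesis
    using flow_ge_1 flow_le_cap cap_degree by (auto simp: degree_flow_LP_feasible_def)
qed

text \<open>The lower bound makes the value positive and bounds the feasible set from below, so that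
  \<open>Inf\<close> is a genuine infimum; the two hubs of index 0 serve as distinct
  endpoints.\<close>

lemma LP_value_bounds:
  "1 \<le> degree_flow_LP_value V E S" "degree_flow_LP_value V E S \<le> 4"
proof -
  have "g (Left 0) \<noteq> g (Right 0)"
    using m_pos by (simp add: g_eq_iff)
  moreover have "g (Left 0) \<in> V" "g (Right 0) \<in> V"
    using m_pos g_less by (auto simp: V_def)
  ultimately have ge: "1 \<le> l" if "degree_flow_LP_feasible V E S c f l" for c f l
    using degree_flow_LP_feasible_ge_1[OF simple_graph that] by blast
  show "1 \<le> degree_flow_LP_value V E S"
    unfolding degree_flow_LP_value_def using LP_feasible ge by (intro cInf_greatest) auto
  show "degree_flow_LP_value V E S \<le> 4"
    unfolding degree_flow_LP_value_def using LP_feasible ge by (intro cInf_lower bdd_belowI) auto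
qed

section \<open>Integral solutions\<close>

text \<open>A unit of flow between every pair leaves no set of safe paths empty, as an empty sum is
  0.\<close>

lemma safely_connected_whole: "safely_connected_subgraph V E S V E"
proof -
  have "\<exists>p. p \<in> safe_paths V E S u v" if "u \<in> V" "v \<in> V" for u v
    using flow_ge_1[OF that] by (cases "safe_paths V E S u v = {}") auto
  then show ?thesis
    using simple_graph by (auto simp: safely_connected_subgraph_def subgraph_def)
qed

text \<open>Inside \<open>group i j\<close> a point is adjacent only to \<open>Left i\<close> and
  one line, and a line only to \<open>Right j\<close> and at most one point. So a simple path
  between the hubs must be a route.\<close>

lemma hub_path_shape:
  assumes ij: "i < m" "j < m" and F: "F \<subseteq> E"
    and p: "p \<in> safe_paths W F S (g (Left i)) (g (Right j))"
  obtains x where "x < m^2" "{g (Left i), g (Point i x)} \<in> F"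
    "{g (Line j (x + i * j)), g (Right j)} \<in> F"
proof -
  have "p \<in> lists (g ` group i j)"
    using p ij by (auto simp: safe_paths_def S_hubs)
  then obtain q where pq: "p = map g q" and q: "set q \<subseteq> group i j"
    by (auto simp: lists_image in_lists_conv_set)
  have qv: "set q \<subseteq> verts m"
    using q group_subset[OF ij] by blast
  have path: "q \<noteq> []" "distinct q" "g (hd q) = g (Left i)" "g (last q) = g (Right j)"
    "successively (\<lambda>r s. {g r, g s} \<in> F) q"
    using p by (auto simp: pq safe_paths_def is_path_def hd_map last_map distinct_map successively_map)
  have ends: "hd q = Left i" "last q = Right j"
    using path(1,3,4) qv ij g_eq_iff[of "hd q" "Left i"] g_eq_iff[of "last q" "Right j"]
    by (auto simp: subset_iff)
  have adj: "link r s \<or> link s r" if "{g r, g s} \<in> F" "r \<in> set q" "s \<in> set q" for r s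
    using that F qv g_edge_iff by blast
  obtain q0 where q0: "q = Left i # q0"
    using path(1) ends by (cases q) auto
  moreover obtain s q1 where "q0 = s # q1"
    using ends by (cases q0) (auto simp: q0)
  ultimately have q1: "q = Left i # s # q1" by simp
  have s: "{g (Left i), g s} \<in> F" "s \<in> group i j"
    using path(5) q by (auto simp: q1)
  then obtain x where x: "s = Point i x" "x < m^2"
    using adj[OF s(1)] by (auto simp: q1 group_def)
  obtain t q2 where q2: "q1 = t # q2"
    using ends x by (cases q1) (auto simp: q1)
  \<comment> \<open>A simple path cannot return to \<open>Left i\<close>, so it moves on to the line
    of slope \<open>j\<close> through the point.\<close>
  have t: "{g s, g t} \<in> F" "t \<in> group i j" "t \<noteq> Left i"
    using path(2,5) q by (auto simp: q1 q2)
  then have t_eq: "t = Line j (x + i * j)"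
    using adj[OF t(1)] x by (auto simp: q1 q2 group_def)
  obtain r q3 where q3: "q2 = r # q3"
    using ends t_eq by (cases q2) (auto simp: q1 q2)
  \<comment> \<open>The only point of column \<open>i\<close> on this line is \<open>s\<close>,
    already visited, so the path continues to \<open>Right j\<close>.\<close>
  have r: "{g t, g r} \<in> F" "r \<in> group i j" "r \<noteq> s"
    using path(2,5) q by (auto simp: q1 q2 q3)
  then have "r = Right j"
    using adj[OF r(1)] t_eq x by (auto simp: q1 q2 q3 group_def)
  then show ?thesis
    using that[of x] s r x t_eq by simp
qed

text \<open>The points adjacent in \<open>F\<close> to left hubs and the lines adjacent to right
  hubs form selections no larger than the maximum degree; the safe hub paths supply the incidences
  that \<open>incidence_bound\<close> asks for.\<close>

lemma safe_degree:
  assumes m: "m = 4 * s ^ 3" and H: "safely_connected_subgraph V E S W F"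
  shows "s < max_degree W F"
proof -
  have sg: "simple_graph W F" and FE: "F \<subseteq> E"
    and ex: "\<And>u v. u \<in> V \<Longrightarrow> v \<in> V \<Longrightarrow> \<exists>p. p \<in> safe_paths W F S u v"
    using H by (auto simp: safely_connected_subgraph_def subgraph_def)
  have finW: "finite W" and nW: "neighbours F u \<subseteq> W" for u
    using sg by (auto simp: simple_graph_def neighbours_def)
  have gV: "g r \<in> V" if "r \<in> verts m" for r
    using g_less that by (simp add: V_def)
  \<comment> \<open>\<open>h\<close> stands for \<open>Point i\<close> or \<open>Line j\<close>, so
    that neighbours of a hub are counted by their last coordinate.\<close>
  have deg: "finite {x. {g r, g (h x)} \<in> F \<and> h x \<in> verts m} \<and>
      card {x. {g r, g (h x)} \<in> F \<and> h x \<in> verts m} \<le> max_degree W F"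
    (is "finite ?X \<and> _")
    if r: "r \<in> verts m" and h: "inj h" for r and h :: "nat \<Rightarrow> vertex"
  proof -
    \<comment> \<open>The demand from \<open>g r\<close> to itself places \<open>g r\<close> in
      \<open>W\<close>, over which \<open>max_degree\<close> takes its maximum.\<close>
    obtain p where "p \<in> safe_paths W F S (g r) (g r)"
      using ex gV[OF r] by blast
    then have "g r \<in> W"
      by (auto simp: safe_paths_def is_path_def dest: hd_in_set)
    then have le: "card (neighbours F (g r)) \<le> max_degree W F"
      unfolding max_degree_def using finW by (intro Max_ge) auto
    have inj: "inj_on (\<lambda>x. g (h x)) ?X"
      using h by (auto simp: inj_on_def g_eq_iff dest: injD)
    have sub: "(\<lambda>x. g (h x)) ` ?X \<subseteq> neighbours F (g r)"
      by (auto simp: neighbours_def)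
    have fin: "finite (neighbours F (g r))"
      using nW finW by (rule finite_subset)
    show ?thesis
      using inj_on_finite[OF inj sub fin] card_inj_on_le[OF inj sub fin] le by simp
  qed
  define P where "P i = {x. {g (Left i), g (Point i x)} \<in> F \<and> Point i x \<in> verts m}" for i
  define Q where "Q j = {y. {g (Right j), g (Line j y)} \<in> F \<and> Line j y \<in> verts m}" for j
  show ?thesis
  proof (rule incidence_bound[OF _ _ _ m])
    show "finite (P i) \<and> card (P i) \<le> max_degree W F" if "i < m" for i
      unfolding P_def using that by (intro deg) (auto simp: inj_def)
    show "finite (Q j) \<and> card (Q j) \<le> max_degree W F" if "j < m" for j
      unfolding Q_def using that by (intro deg) (auto simp: inj_def)
    show "0 < s"
      using m m_pos by (cases s) auto
    fix i j assume ij: "i < m" "j < m"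
    then obtain p where "p \<in> safe_paths W F S (g (Left i)) (g (Right j))"
      using ex[OF gV gV, of "Left i" "Right j"] by auto
    from ij FE this obtain x where x: "x < m^2" "{g (Left i), g (Point i x)} \<in> F"
      "{g (Line j (x + i * j)), g (Right j)} \<in> F"
      by (rule hub_path_shape)
    then have "x \<in> P i" "x + i * j \<in> Q j"
      using ij line_less[OF ij x(1)] by (auto simp: P_def Q_def insert_commute)
    then show "\<exists>x\<in>P i. x + i * j \<in> Q j" ..
  qed
qed

end

section \<open>Choice of parameters and the gap\<close>

lemma incidence_instance_exists:
  assumes "0 < m"
  obtains g where "incidence_instance m (2 * card (verts m)) g"
proof -
  obtain h where h: "bij_betw h (verts m) {0..<card (verts m)}"
    using ex_bij_betw_finite_nat[OF finite_verts] by blast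
  \<comment> \<open>Doubling an arbitrary enumeration makes all numbers even.\<close>
  have "incidence_instance m (2 * card (verts m)) (\<lambda>r. 2 * h r)"
    using assms h by unfold_locales (auto simp: bij_betw_def inj_on_def)
  then show ?thesis by (rule that)
qed

theorem theorem22:
  fixes \<epsilon> :: real
  assumes "\<epsilon> > 0"
  shows "\<exists>C>0. \<forall>N::nat. \<exists>(V :: nat set) E S.
           card V \<ge> N \<and>
           constrained_connectivity_instance V E S \<and>
           (\<exists>W F. safely_connected_subgraph V E S W F) \<and>
           degree_flow_LP_value V E S > 0 \<and>
           real (min_safe_degree V E S) \<ge>
             C * real (card V) powr (1 / 9 - \<epsilon>) * degree_flow_LP_value V E S"
proof (intro exI[of _ "1 / 12 :: real"] conjI allI)
  fix N :: nat
  define s where "s = Suc N"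
  define m where "m = 4 * s ^ 3"
  define n where "n = 2 * card (verts m)"
  have "0 < m"
    by (simp add: m_def s_def)
  then obtain g where "incidence_instance m n g"
    unfolding n_def by (rule incidence_instance_exists)
  then interpret incidence_instance m n g .
  have card_V: "card V = n"
    by (simp add: V_def)
  have "N \<le> s ^ 3"
    using self_le_power[of s 3] by (simp add: s_def)
  then have large: "N \<le> n"
    using card_verts_ge[of m] by (simp add: n_def m_def)
  have "n \<le> 10 * m ^ 3"
    using card_verts_le[of m] by (simp add: n_def)
  \<comment> \<open>Here \<open>10 * 4 ^ 3 = 640\<close> is below \<open>3 ^ 9\<close>; a ninth
    power on the right lets the root be taken exactly.\<close>
  also have "\<dots> \<le> (3 * s) ^ 9"
    by (simp add: m_def power_mult_distrib flip: power_mult)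
  finally have n_le: "real n \<le> real (3 * s) ^ 9"
    by (metis of_nat_le_iff of_nat_power)
  have "1 \<le> n"
    using large card_verts_ge[of m] \<open>0 < m\<close> by (simp add: n_def)
  \<comment> \<open>As \<open>n\<close> is at least 1, the exponent may be raised to
    \<open>1 / 9\<close>.\<close>
  then have "real n powr (1 / 9 - \<epsilon>) \<le> real n powr (1 / 9)"
    using assms by (intro powr_mono) auto
  also have "\<dots> \<le> (real (3 * s) ^ 9) powr (1 / 9)"
    using n_le by (intro powr_mono2) auto
  also have "\<dots> = 3 * s"
    using powr_powr[of "real (3 * s)" 9 "1 / 9"] powr_numeral[of "real (3 * s)"]
    by (simp add: s_def)
  finally have n_powr: "real n powr (1 / 9 - \<epsilon>) \<le> 3 * s" .
  have "\<exists>W F. safely_connected_subgraph V E S W F \<and> min_safe_degree V E S = max_degree W F"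
    unfolding min_safe_degree_def by (rule LeastI_ex) (use safely_connected_whole in blast)
  then have degree: "s < min_safe_degree V E S"
    using safe_degree[OF m_def] by auto
  \<comment> \<open>The factor 3 comes from the bound on \<open>n\<close> and the factor 4 from the
    value of the linear program; the constant \<open>1 / 12\<close> cancels both and leaves
    \<open>s\<close>.\<close>
  have "1 / 12 * real (card V) powr (1 / 9 - \<epsilon>) * degree_flow_LP_value V E S
      \<le> 1 / 12 * (3 * s) * 4"
    using n_powr LP_value_bounds by (intro mult_mono) (auto simp: card_V)
  also have "\<dots> \<le> real (min_safe_degree V E S)"
    using degree by simp
  finally show "\<exists>(V :: nat set) E S.
           card V \<ge> N \<and>
           constrained_connectivity_instance V E S \<and>
           (\<exists>W F. safely_connected_subgraph V E S W F) \<and>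
           degree_flow_LP_value V E S > 0 \<and>
           real (min_safe_degree V E S) \<ge>
             1 / 12 * real (card V) powr (1 / 9 - \<epsilon>) * degree_flow_LP_value V E S"
    using large card_V instance_constrained_connectivity safely_connected_whole LP_value_bounds(1)
    by (intro exI[of _ V] exI[of _ E] exI[of _ S]) auto
qed simp

end
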